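(* Let $M\in\mathbb{C}^{p\times p}$ be nonsingular, let $\mathcal{A}\in\mathbb{C}^{m\times m\times p}$ have tubal index $k$, and let $\mathcal{B}\in\mathbb{C}^{m\times 1\times p}$. The general solution $\mathcal{Y}\in\mathbb{C}^{m\times 1\times p}$ of $$\mathcal{A}^k*_M\mathcal{Y}=\mathcal{A}^k*_M\mathcal{A}^\dagger*_M\mathcal{B}$$ is $\mathcal{Y}=\mathcal{A}^{c,\dagger}*_M\mathcal{B}+(\mathcal{I}-\mathcal{A}^{c,\dagger}*_M\mathcal{A})*_M\mathcal{Z}$, where $\mathcal{Z}\in\mathbb{C}^{m\times 1\times p}$ is arbitrary; that is, the set of solutions is exactly the set of tensors of this form.
   Context: Transform: for $\mathcal{A}\in\mathbb{C}^{m\times n\times p}$, $\tilde{\mathcal{A}}=\mathcal{A}\times_3 M\in\mathbb{C}^{m\times n\times p}$ is given by $(\tilde{\mathcal{A}})_{ijk}=\sum_{s=1}^p(\mathcal{A})_{ijs}M_{ks}$, and $\tilde{\mathcal{A}}^{(i)}=\tilde{\mathcal{A}}(:,:,i)$ is its $i$th frontal slice. Since $M$ is nonsingular, $\mathcal{A}\mapsto\tilde{\mathcal{A}}$ is a bijection. $M$-product: for $\mathcal{A}\in\mathbb{C}^{m\times n\times p}$, $\mathcal{B}\in\mathbb{C}^{n\times l\times p}$, $\mathcal{A}*_M\mathcal{B}$ is the unique $\mathcal{C}\in\mathbb{C}^{m\times l\times p}$ with $\tilde{\mathcal{C}}^{(i)}=\tilde{\mathcal{A}}^{(i)}\tilde{\mathcal{B}}^{(i)}$,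 $i=1,\dots,p$. The identity tensor $\mathcal{I}$ has $\tilde{\mathcal{I}}^{(i)}=I_m$ for all $i$; powers are taken with respect to $*_M$, with $\mathcal{A}^0=\mathcal{I}$. The conjugate transpose $\mathcal{A}^*$ is the tensor whose transform has $i$th frontal slice $(\tilde{\mathcal{A}}^{(i)})^{*}$ (matrix conjugate transpose). Tubal index of $\mathcal{A}\in\mathbb{C}^{m\times m\times p}$: $k=\max_{1\le i\le p}\mathrm{ind}(\tilde{\mathcal{A}}^{(i)})$, where $\mathrm{ind}(A)$ is the least integer $k\ge 0$ with $\mathrm{rank}(A^k)=\mathrm{rank}(A^{k+1})$. Drazin inverse: for $\mathcal{A}$ of tubal index $k$, $\mathcal{A}^{\mathrm D}$ is the unique $\mathcal{X}\in\mathbb{C}^{m\times m\times p}$ with $\mathcal{X}*_M\mathcal{A}*_M\mathcal{X}=\mathcal{X}$, $\mathcal{A}*_M\mathcal{X}=\mathcal{X}*_M\mathcal{A}$ and $\mathcal{X}*_M\mathcal{A}^{k+1}=\mathcal{A}^k$. Moore–Penrose inverse: $\mathcal{A}^\dagger$ is the unique $\mathcal{X}$ with $\mathcal{A}*_M\mathcal{X}*_M\mathcal{A}=\mathcal{A}$, $\mathcal{X}*_M\mathcal{A}*_M\mathcal{X}=\mathcal{X}$, $(\mathcal{A}*_M\mathcal{X})^*=\mathcal{A}*_M\mathcal{X}$, $(\mathcal{X}*_M\mathcal{A})^*=\mathcal{X}*_M\mathcal{A}$. CMP inverse: $\mathcal{A}^{c,\dagger}=\mathcal{A}^\dagger*_M\mathcal{A}*_M\mathcal{A}^{\mathrm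 D}*_M\mathcal{A}*_M\mathcal{A}^\dagger$. *)

theory Defs
  imports "HOL-Analysis.Analysis"
begin

text \<open>
  An \<open>m \<times> n \<times> p\<close> tensor is indexed as \<open>A $ i $ j $ k\<close>, so its frontal slices are obtained by
  fixing the innermost index.  Addition, subtraction and zero of tensors are the library's
  componentwise ones; the library's \<open>*\<close> and \<open>1\<close> on vectors are componentwise too and are not used.
\<close>

type_synonym ('p, 'n, 'm) tensor = "(((complex, 'p) vec, 'n) vec, 'm) vec"

definition frontal_slice ::
    "('p::finite, 'n::finite, 'm::finite) tensor \<Rightarrow> 'p \<Rightarrow> complex^'n^'m" where
  "frontal_slice A k = (\<chi> i j. A $ i $ j $ k)"

text \<open>The mode-3 product of \<open>A\<close> with \<open>M\<close>.\<close>

definition transform ::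
    "complex^'p^'p \<Rightarrow> ('p::finite, 'n::finite, 'm::finite) tensor \<Rightarrow> ('p, 'n, 'm) tensor" where
  "transform M A = (\<chi> i j k. \<Sum>s\<in>UNIV. A $ i $ j $ s * M $ k $ s)"

abbreviation transform_slice ::
    "complex^'p^'p \<Rightarrow> ('p::finite, 'n::finite, 'm::finite) tensor \<Rightarrow> 'p \<Rightarrow> complex^'n^'m" where
  "transform_slice M A i \<equiv> frontal_slice (transform M A) i"

definition mprod ::
    "complex^'p^'p \<Rightarrow> ('p::finite, 'n::finite, 'm::finite) tensor \<Rightarrow>
      ('p, 'l::finite, 'n) tensor \<Rightarrow> ('p, 'l, 'm) tensor" where
  "mprod M A B =
    (THE C. \<forall>i. transform_slice M C i = transform_slice M A i ** transform_slice M B i)"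

abbreviation mprod_infix ("(_ \<star>\<^bsub>_\<^esub> _)" [70, 0, 71] 70) where
  "A \<star>\<^bsub>M\<^esub> B \<equiv> mprod M A B"

definition ident_tensor :: "complex^'p^'p \<Rightarrow> ('p::finite, 'm::finite, 'm) tensor" where
  "ident_tensor M = (THE E. \<forall>i. transform_slice M E i = mat 1)"

primrec mpower ::
    "complex^'p^'p \<Rightarrow> ('p::finite, 'm::finite, 'm) tensor \<Rightarrow> nat \<Rightarrow> ('p, 'm, 'm) tensor" where
  "mpower M A 0 = ident_tensor M"
| "mpower M A (Suc n) = A \<star>\<^bsub>M\<^esub> mpower M A n"

definition conj_transpose :: "complex^'n^'m \<Rightarrow> complex^'m^'n" where
  "conj_transpose A = map_matrix cnj (transpose A)"

definition tensor_conj_transpose ::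
    "complex^'p^'p \<Rightarrow> ('p::finite, 'n::finite, 'm::finite) tensor \<Rightarrow> ('p, 'm, 'n) tensor" where
  "tensor_conj_transpose M A =
    (THE C. \<forall>i. transform_slice M C i = conj_transpose (transform_slice M A i))"

primrec matrix_power :: "complex^'m^'m \<Rightarrow> nat \<Rightarrow> complex^'m^'m" where
  "matrix_power A 0 = mat 1"
| "matrix_power A (Suc n) = A ** matrix_power A n"

definition matrix_index :: "complex^'m^'m \<Rightarrow> nat" where
  "matrix_index A = (LEAST k. rank (matrix_power A k) = rank (matrix_power A (k + 1)))"

definition tubal_index ::
    "complex^'p^'p \<Rightarrow> ('p::finite, 'm::finite, 'm) tensor \<Rightarrow> nat" where
  "tubal_index M A = Max (range (\<lambda>i. matrix_index (transform_slice M A i)))"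

definition drazin_inverse ::
    "complex^'p^'p \<Rightarrow> ('p::finite, 'm::finite, 'm) tensor \<Rightarrow> ('p, 'm, 'm) tensor" where
  "drazin_inverse M A =
    (THE X. X \<star>\<^bsub>M\<^esub> A \<star>\<^bsub>M\<^esub> X = X \<and>
            A \<star>\<^bsub>M\<^esub> X = X \<star>\<^bsub>M\<^esub> A \<and>
            X \<star>\<^bsub>M\<^esub> mpower M A (tubal_index M A + 1) = mpower M A (tubal_index M A))"

definition moore_penrose_inverse ::
    "complex^'p^'p \<Rightarrow> ('p::finite, 'n::finite, 'm::finite) tensor \<Rightarrow> ('p, 'm, 'n) tensor" where
  "moore_penrose_inverse M A =
    (THE X. A \<star>\<^bsub>M\<^esub> X \<star>\<^bsub>M\<^esub> A = A \<and>
            X \<star>\<^bsub>M\<^esub> A \<star>\<^bsub>M\<^esub> X = X \<and>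
            tensor_conj_transpose M (A \<star>\<^bsub>M\<^esub> X) = A \<star>\<^bsub>M\<^esub> X \<and>
            tensor_conj_transpose M (X \<star>\<^bsub>M\<^esub> A) = X \<star>\<^bsub>M\<^esub> A)"

definition cmp_inverse ::
    "complex^'p^'p \<Rightarrow> ('p::finite, 'm::finite, 'm) tensor \<Rightarrow> ('p, 'm, 'm) tensor" where
  "cmp_inverse M A =
    moore_penrose_inverse M A \<star>\<^bsub>M\<^esub> A \<star>\<^bsub>M\<^esub> drazin_inverse M A \<star>\<^bsub>M\<^esub> A \<star>\<^bsub>M\<^esub> moore_penrose_inverse M A"

text \<open>
  For nonsingular \<open>M\<close> a tensor is determined by arbitrarily prescribed transformed slices, so the
  definite descriptions in \<open>mprod\<close>, \<open>ident_tensor\<close> and \<open>tensor_conj_transpose\<close> are meaningful.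
\<close>

lemma transform_nth: "transform M A $ i $ j = M *v (A $ i $ j)"
  by (simp add: transform_def matrix_vector_mult_def vec_eq_iff mult.commute)

lemma ex1_transform_slice:
  fixes M :: "complex^'p^'p" and F :: "'p::finite \<Rightarrow> complex^'n^'m"
  assumes "invertible M"
  shows "\<exists>!C. \<forall>i. transform_slice M C i = F i"
proof -
  obtain N where N: "M ** N = mat 1" "N ** M = mat 1"
    using assms unfolding invertible_def by blast
  have slices: "(\<forall>i. transform_slice M C i = F i) \<longleftrightarrow> (\<forall>a b. M *v (C $ a $ b) = (\<chi> i. F i $ a $ b))"
    for C :: "('p, 'n, 'm) tensor"
    by (auto simp: frontal_slice_def vec_eq_iff transform_nth)
  have inv: "M *v x = y \<longleftrightarrow> x = N *v y" for x y
    by (metis N matrix_vector_mul_assoc matrix_vector_mul_lid)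
  show ?thesis
    unfolding slices inv
    by (rule ex1I[where a = "\<chi> a b. N *v (\<chi> i. F i $ a $ b)"]) (simp_all add: vec_eq_iff)
qed

lemma transform_slice_mprod:
  assumes "invertible M"
  shows "transform_slice M (A \<star>\<^bsub>M\<^esub> B) i = transform_slice M A i ** transform_slice M B i"
  using theI'[OF ex1_transform_slice[OF assms,
      of "\<lambda>i. transform_slice M A i ** transform_slice M B i"]]
  by (simp add: mprod_def)

lemma transform_slice_ident_tensor:
  assumes "invertible M"
  shows "transform_slice M (ident_tensor M) i = (mat 1 :: complex^'m^'m)"
  using theI'[OF ex1_transform_slice[OF assms, of "\<lambda>i. mat 1 :: complex^'m^'m"]]
  by (simp add: ident_tensor_def)

lemma transform_slice_tensor_conj_transpose:
  assumes "invertible M"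
  shows "transform_slice M (tensor_conj_transpose M A) i = conj_transpose (transform_slice M A i)"
  using theI'[OF ex1_transform_slice[OF assms,
      of "\<lambda>i. conj_transpose (transform_slice M A i)"]]
  by (simp add: tensor_conj_transpose_def)

end

theory Submission
  imports Defs
begin

text \<open>
  The transform turns the \<open>M\<close>-product into the ordinary product of each frontal slice, so the theorem
  reduces to one matrix \<open>A\<close> at a time.  The number \<open>k\<close> then bounds the index of every slice, which makes
  \<open>A\<^sup>D\<close> a solution of \<open>A\<^sup>D A\<^sup>k\<^sup>+\<^sup>1 = A\<^sup>k\<close> on each of them.  The definite descriptions denote the
  intended inverses by \<open>exists_drazin_inverse\<close>, \<open>drazin_inverse_unique\<close>,
  \<open>exists_moore_penrose_inverse\<close>, \<open>moore_penrose_inverse_unique\<close> and \<open>transform_slice_The\<close>.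

  On one slice put \<open>C = A\<^sup>\<dagger> A A\<^sup>D A A\<^sup>\<dagger>\<close>.  The Drazin equations give \<open>A\<^sup>k A\<^sup>D A = A\<^sup>k\<close>, and therefore also
  \<open>A\<^sup>k A\<^sup>\<dagger> A = A\<^sup>k\<close>, even when \<open>k = 0\<close>.  Hence \<open>A\<^sup>k C = A\<^sup>k A\<^sup>\<dagger>\<close> and \<open>A\<^sup>k C A = A\<^sup>k\<close>: \<open>C B\<close> solves the
  equation and \<open>I - C A\<close> maps into the kernel of \<open>A\<^sup>k\<close>.  Conversely the projection \<open>A\<^sup>D A\<close> has the form
  \<open>W A\<^sup>k\<close>, so that both \<open>C A Y = A\<^sup>\<dagger> A W A\<^sup>k Y\<close> and \<open>C B = A\<^sup>\<dagger> A W A\<^sup>k A\<^sup>\<dagger> B\<close> only depend on the two sides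
  of the equation; a solution \<open>Y\<close> thus satisfies \<open>C A Y = C B\<close>, which says that \<open>Y\<close> is the
  claimed expression with \<open>Z = Y\<close>.
\<close>

section \<open>Matrices over a field\<close>

text \<open>Take a linear right inverse of \<open>A\<close> on the range of \<open>A\<close>.\<close>

lemma exists_inner_inverse:
  fixes A :: "'a::field^'n^'m"
  obtains G where "A ** G ** A = A"
proof -
  obtain g where g: "Vector_Spaces.linear (*s) (*s) g" "\<And>x. A *v g (A *v x) = A *v x"
    using vec.linear_exists_right_inverse_on[OF matrix_vector_mul_linear_gen vec.subspace_UNIV, of A]
    by auto
  then have "A ** matrix g ** A = A"
    by (simp add: matrix_eq matrix_works flip: matrix_vector_mul_assoc)
  with that show thesis by blast
qed

lemma vec_subspace_row_combinations:
  fixes A :: "'a::field^'n^'m"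
  shows "vec.subspace (range (\<lambda>x. x v* A))"
proof (rule vec.subspaceI)
  show "0 \<in> range (\<lambda>x. x v* A)"
    by (metis rangeI vector_matrix_mult_0)
  show "x + y \<in> range (\<lambda>x. x v* A)" if "x \<in> range (\<lambda>x. x v* A)" "y \<in> range (\<lambda>x. x v* A)" for x y
    using that by (auto simp flip: vector_matrix_left_distrib)
  show "c *s x \<in> range (\<lambda>x. x v* A)" if "x \<in> range (\<lambda>x. x v* A)" for c x
    using that by (auto simp flip: scalar_vector_matrix_assoc)
qed

lemma row_matrix_mult:
  fixes A :: "'a::field^'n^'m" and Y :: "'a^'m^'l"
  shows "row i (Y ** A) = row i Y v* A"
  by (simp add: row_def matrix_matrix_mult_def vector_matrix_mult_def vec_eq_iff mult.commute)

lemma span_rows_eq: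
  fixes A :: "'a::field^'n^'m"
  shows "vec.span (rows A) = range (\<lambda>x. x v* A)"
proof (rule vec.span_subspace[OF _ _ vec_subspace_row_combinations])
  have "row i A = row i (mat 1) v* A" for i
    using row_matrix_mult[of i "mat 1" A] by simp
  then show "rows A \<subseteq> range (\<lambda>x. x v* A)"
    by (auto simp: rows_def)
  show "range (\<lambda>x. x v* A) \<subseteq> vec.span (rows A)"
  proof clarify
    fix x :: "'a^'m"
    have "x v* A = (\<Sum>i\<in>UNIV. x $ i *s row i A)"
      by (simp add: vector_matrix_mult_def row_def vec_eq_iff mult.commute)
    also have "\<dots> \<in> vec.span (rows A)"
      by (intro vec.span_sum vec.span_scale vec.span_base) (auto simp: rows_def)
    finally show "x v* A \<in> vec.span (rows A)" .
  qed
qed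

lemma rows_matrix_mult_subset:
  fixes A :: "'a::field^'n^'m" and B :: "'a^'m^'l"
  shows "rows (B ** A) \<subseteq> vec.span (rows A)"
  by (auto simp: rows_def[of "B ** A"] row_matrix_mult span_rows_eq)

lemma rank_matrix_mult_le:
  fixes A :: "'a::field^'n^'m" and B :: "'a^'m^'l"
  shows "rank (B ** A) \<le> rank A"
  by (metis row_rank_def_gen rows_matrix_mult_subset vec.dim_mono)

text \<open>Equal rank forces the two row spaces to coincide, so each row of \<open>A\<close> is a linear
  combination of rows of \<open>B ** A\<close>.\<close>

lemma left_factor_of_rank_eq:
  fixes A :: "'a::field^'n^'m" and B :: "'a^'m^'l"
  assumes "rank (B ** A) = rank A"
  obtains Y where "A = Y ** (B ** A)"
proof -
  have "vec.span (rows (B ** A)) = vec.span (rows A)"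
    using assms rows_matrix_mult_subset[of B A]
    by (metis order_refl row_rank_def_gen vec.dim_eq_span vec.dim_span vec.span_span)
  then have "\<forall>i. \<exists>x. row i A = x v* (B ** A)"
    unfolding span_rows_eq using row_matrix_mult[of _ "mat 1" A] by (simp add: set_eq_iff image_iff) metis
  then obtain y where y: "\<And>i. row i A = y i v* (B ** A)"
    by metis
  have "row i A = row i ((\<chi> i. y i) ** (B ** A))" for i
    using y by (simp only: row_matrix_mult) (simp add: row_def)
  then have "A = (\<chi> i. y i) ** (B ** A)"
    by (simp add: row_def vec_eq_iff)
  with that show thesis by blast
qed

section \<open>Powers and the index of a matrix\<close>

lemma matrix_power_add: "matrix_power A (i + j) = matrix_power A i ** matrix_power A j"
  by (induction i) (simp_all add: matrix_mul_assoc)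

lemma matrix_power_Suc_right: "matrix_power A (Suc n) = matrix_power A n ** A"
  using matrix_power_add[of A n 1] by simp

lemma matrix_power_commute:
  assumes "A ** X = X ** A"
  shows "matrix_power A n ** X = X ** matrix_power A n"
  by (induction n) (simp_all, metis assms matrix_mul_assoc)

text \<open>The rank cannot grow from one power to the next, so it stays the same after a power of least
  rank; the least number in the definition of the index therefore exists.\<close>

lemma rank_matrix_index:
  "rank (matrix_power A (matrix_index A)) = rank (matrix_power A (matrix_index A + 1))"
proof -
  obtain n where n: "\<And>k. rank (matrix_power A n) \<le> rank (matrix_power A k)"
    using ex_has_least_nat[of "\<lambda>_. True" 0 "\<lambda>n. rank (matrix_power A n)"] by auto
  have "rank (matrix_power A n) = rank (matrix_power A (n + 1))"
    using n[of "n + 1"] rank_matrix_mult_le[of A "matrix_power A n"] by simp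
  then show ?thesis
    unfolding matrix_index_def by (rule LeastI)
qed

lemma matrix_power_left_factor:
  assumes "matrix_index A \<le> k"
  obtains Y where "matrix_power A k = Y ** matrix_power A (k + 1)"
proof -
  obtain Y where "matrix_power A (matrix_index A) = Y ** matrix_power A (matrix_index A + 1)"
    using left_factor_of_rank_eq[of A "matrix_power A (matrix_index A)"] rank_matrix_index[of A]
    by auto
  then have "matrix_power A (matrix_index A + (k - matrix_index A))
      = Y ** matrix_power A (matrix_index A + 1 + (k - matrix_index A))"
    by (simp only: matrix_power_add matrix_mul_assoc)
  with assms that show thesis by auto
qed

text \<open>A left factorisation makes \<open>A\<close> injective on the range of \<open>A\<^sup>k\<close>, which \<open>A\<close> maps into itself;
  comparing dimensions, \<open>A\<close> maps that range onto itself.\<close>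

lemma matrix_power_right_factor:
  assumes Y: "matrix_power A k = Y ** matrix_power A (k + 1)"
  obtains X where "matrix_power A k = matrix_power A (k + 1) ** X"
proof -
  let ?V = "range ((*v) (matrix_power A k))"
  have sub: "vec.subspace ?V"
    by (rule vec.subspace_image[OF vec.subspace_UNIV])
  have image: "(*v) A ` ?V = range ((*v) (matrix_power A (k + 1)))"
    by (auto simp: image_image matrix_vector_mul_assoc)
  have inj: "inj_on ((*v) A) ?V"
  proof (rule inj_onI)
    fix u v assume "u \<in> ?V" "v \<in> ?V" and eq: "A *v u = A *v v"
    then obtain a b where ab: "u = matrix_power A k *v a" "v = matrix_power A k *v b"
      by auto
    then have "matrix_power A (k + 1) *v a = matrix_power A (k + 1) *v b"
      using eq by (simp add: matrix_vector_mul_assoc)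
    then show "u = v"
      unfolding ab Y by (metis matrix_vector_mul_assoc)
  qed
  have "(*v) A ` ?V = ?V"
  proof (rule vec.subspace_dim_equal)
    show "vec.subspace ((*v) A ` ?V)"
      by (rule vec.subspace_image[OF sub])
    show "(*v) A ` ?V \<subseteq> ?V"
      unfolding image by (auto simp: matrix_power_Suc_right simp flip: matrix_vector_mul_assoc
          simp del: matrix_power.simps)
    show "vec.dim ?V \<le> vec.dim ((*v) A ` ?V)"
      using vec.dim_image_eq[of "(*v) A" ?V] inj sub by (simp add: vec.span_eq_iff[THEN iffD2])
  qed (rule sub)
  then have range: "range ((*v) (matrix_power A k)) = range ((*v) (matrix_power A (k + 1)))"
    unfolding image ..
  obtain G where G: "matrix_power A (k + 1) ** G ** matrix_power A (k + 1) = matrix_power A (k + 1)"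
    by (rule exists_inner_inverse)
  have "matrix_power A (k + 1) *v (G *v w) = w" if w: "w \<in> ?V" for w
  proof -
    obtain z where "w = matrix_power A (k + 1) *v z"
      using w unfolding range by auto
    then show ?thesis
      using G by (metis matrix_vector_mul_assoc)
  qed
  then have "matrix_power A k = matrix_power A (k + 1) ** (G ** matrix_power A k)"
    unfolding matrix_eq by (simp add: matrix_vector_mul_assoc[symmetric] del: matrix_power.simps)
  with that show thesis by blast
qed

section \<open>The Drazin inverse of a matrix\<close>

definition is_drazin_inverse :: "complex^'m^'m \<Rightarrow> nat \<Rightarrow> complex^'m^'m \<Rightarrow> bool" where
  "is_drazin_inverse A k X \<longleftrightarrow>
    X ** A ** X = X \<and> A ** X = X ** A \<and> X ** matrix_power A (k + 1) = matrix_power A k"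

text \<open>If \<open>A\<^sup>k = Y A\<^sup>k\<^sup>+\<^sup>1 = A\<^sup>k\<^sup>+\<^sup>1 X\<close>, iterating both factorisations shows that
  \<open>A\<^sup>k X\<^sup>k\<^sup>+\<^sup>1\<close> is a Drazin inverse; only monoid laws are involved from there on.\<close>

lemma exists_drazin_inverse:
  fixes A :: "complex^'m^'m"
  assumes "matrix_index A \<le> k"
  obtains X where "is_drazin_inverse A k X"
proof -
  obtain Y where Y: "matrix_power A k = Y ** matrix_power A (k + 1)"
    using matrix_power_left_factor[OF assms] .
  obtain X where X: "matrix_power A k = matrix_power A (k + 1) ** X"
    using matrix_power_right_factor[OF Y] .
  have powX: "matrix_power A (k + n) ** matrix_power X n = matrix_power A k" for n
  proof (induction n)
    case (Suc n)
    have "matrix_power A (k + Suc n) ** matrix_power X (Suc n)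
        = matrix_power A n ** (matrix_power A (k + 1) ** X) ** matrix_power X n"
      using matrix_power_add[of A n "k + 1"]
      by (simp add: matrix_mul_assoc add.commute del: matrix_power.simps(2))
         (simp add: matrix_mul_assoc)
    also have "\<dots> = matrix_power A (k + n) ** matrix_power X n"
      by (simp only: X[symmetric] matrix_power_add[symmetric] add.commute[of n k])
    finally show ?case using Suc.IH by simp
  qed simp
  have powY: "matrix_power Y n ** matrix_power A (k + n) = matrix_power A k" for n
  proof (induction n)
    case (Suc n)
    have "matrix_power Y (Suc n) ** matrix_power A (k + Suc n)
        = matrix_power Y n ** (Y ** matrix_power A (k + 1)) ** matrix_power A n"
      using matrix_power_add[of A "k + 1" n]
      by (simp add: matrix_mul_assoc matrix_power_Suc_right[of Y] del: matrix_power.simps(2))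
    also have "\<dots> = matrix_power Y n ** matrix_power A (k + n)"
      by (simp only: Y[symmetric]) (simp only: matrix_power_add matrix_mul_assoc)
    finally show ?case using Suc.IH by simp
  qed simp
  define D where "D = matrix_power A k ** matrix_power X (k + 1)"
  \<comment> \<open>Both descriptions of \<open>D\<close> equal \<open>Y\<^sup>k\<^sup>+\<^sup>1 A\<^sup>2\<^sup>k\<^sup>+\<^sup>1 X\<^sup>k\<^sup>+\<^sup>1\<close>.
    The one with \<open>X\<close> evaluates \<open>A ** D\<close>, the one with \<open>Y\<close> evaluates \<open>D ** A\<close>.\<close>
  have D': "D = matrix_power Y (k + 1) ** matrix_power A k"
    unfolding D_def by (metis powX powY matrix_mul_assoc)
  have AD: "A ** D = matrix_power A k ** matrix_power X k"
  proof -
    have "A ** D = matrix_power A (k + 1) ** X ** matrix_power X k"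
      by (simp add: D_def matrix_mul_assoc)
    then show ?thesis
      by (simp only: X[symmetric])
  qed
  have DA: "D ** A = matrix_power Y k ** matrix_power A k"
  proof -
    have "D ** A = matrix_power Y k ** (Y ** matrix_power A (k + 1))"
      by (simp add: D' matrix_mul_assoc matrix_power_Suc_right del: matrix_power.simps(2))
    then show ?thesis
      by (simp only: Y[symmetric])
  qed
  have comm: "A ** D = D ** A"
    unfolding AD DA by (metis powX powY matrix_mul_assoc)
  have outer: "D ** A ** D = D"
    unfolding DA unfolding D_def
    by (metis powY matrix_power_add matrix_mul_assoc)
  have power: "D ** matrix_power A (k + 1) = matrix_power A k"
    unfolding D' by (metis powY matrix_power_add matrix_mul_assoc)
  show thesis
    by (rule that[of D]) (simp only: is_drazin_inverse_def comm outer power simp_thms)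
qed

text \<open>The idempotent \<open>X ** A\<close> equals \<open>X\<^sup>n ** A\<^sup>n\<close> for every \<open>n > 0\<close>; for \<open>n = 0\<close> the left factor is
  \<open>X ** A\<close> itself.\<close>

lemma drazin_projection_factor:
  assumes "X ** A ** X = X" "A ** X = X ** A"
  obtains W where "X ** A = W ** matrix_power A n" "X ** A = matrix_power A n ** W"
proof -
  have "\<exists>W. A ** W = W ** A \<and> X ** A = W ** matrix_power A n"
  proof (induction n)
    case 0
    have "A ** (X ** A) = X ** A ** A"
      by (simp only: assms(2) matrix_mul_assoc)
    then show ?case by (intro exI[of _ "X ** A"]) simp
  next
    case (Suc n)
    then obtain W where W: "A ** W = W ** A" "X ** A = W ** matrix_power A n"
      by blast
    have "X ** A = X ** (X ** A) ** A"
      by (metis assms matrix_mul_assoc)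
    also have "\<dots> = X ** W ** matrix_power A (Suc n)"
      by (simp only: W(2) matrix_power_Suc_right matrix_mul_assoc)
    finally show ?case
      by (metis W(1) assms(2) matrix_mul_assoc)
  qed
  then obtain W where W: "A ** W = W ** A" "X ** A = W ** matrix_power A n"
    by blast
  then show thesis
    using that[of W] matrix_power_commute[of A W n] by simp
qed

text \<open>For two candidates the idempotents \<open>E = X ** A\<close> and \<open>F = Y ** A\<close> satisfy \<open>E = E ** F = F\<close>,
  since each of them factors through \<open>A\<^sup>k\<close>, on which the other acts as the identity from either side.\<close>

lemma drazin_inverse_unique:
  assumes X: "is_drazin_inverse A k X" and Y: "is_drazin_inverse A k Y"
  shows "X = Y"
proof -
  have X': "X ** A ** X = X" "A ** X = X ** A" "X ** A ** matrix_power A k = matrix_power A k"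
    and Y': "Y ** A ** Y = Y" "A ** Y = Y ** A" "Y ** A ** matrix_power A k = matrix_power A k"
    using X Y by (simp_all add: is_drazin_inverse_def matrix_mul_assoc)
  have Yr: "matrix_power A k ** (Y ** A) = matrix_power A k"
    by (metis Y'(2,3) matrix_power_commute matrix_mul_assoc matrix_power.simps(2) matrix_power_Suc_right)
  obtain V where V: "X ** A = V ** matrix_power A k"
    using drazin_projection_factor[OF X'(1,2)] by metis
  obtain W where W: "Y ** A = matrix_power A k ** W"
    using drazin_projection_factor[OF Y'(1,2)] by metis
  have "X ** A = X ** A ** (Y ** A)"
    unfolding V by (simp only: Yr flip: matrix_mul_assoc)
  moreover have "Y ** A = X ** A ** (Y ** A)"
    unfolding W by (simp only: X'(3) matrix_mul_assoc)
  ultimately have "X ** A = Y ** A" by simp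
  then show ?thesis
    by (metis X'(1,2) Y'(1,2) matrix_mul_assoc)
qed

section \<open>The Moore-Penrose inverse of a matrix\<close>

definition is_moore_penrose_inverse :: "complex^'n^'m \<Rightarrow> complex^'m^'n \<Rightarrow> bool" where
  "is_moore_penrose_inverse A X \<longleftrightarrow>
    A ** X ** A = A \<and> X ** A ** X = X \<and>
    conj_transpose (A ** X) = A ** X \<and> conj_transpose (X ** A) = X ** A"

lemma conj_transpose_mult: "conj_transpose (A ** B) = conj_transpose B ** conj_transpose A"
  by (simp add: conj_transpose_def map_matrix_def transpose_def matrix_matrix_mult_def vec_eq_iff
      cnj_sum mult.commute)

lemma conj_transpose_conj_transpose [simp]: "conj_transpose (conj_transpose A) = A"
  by (simp add: conj_transpose_def map_matrix_def transpose_def vec_eq_iff)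

text \<open>The diagonal entries of \<open>A\<^sup>* ** A\<close> are the squared norms of the columns of \<open>A\<close>.\<close>

lemma conj_transpose_mult_self_eq_0:
  assumes "conj_transpose A ** A = 0"
  shows "A = 0"
proof -
  have "A $ i $ j = 0" for i j
  proof -
    have "complex_of_real (\<Sum>i\<in>UNIV. (cmod (A $ i $ j))\<^sup>2) = (conj_transpose A ** A) $ j $ j"
      by (simp add: conj_transpose_def map_matrix_def transpose_def matrix_matrix_mult_def
          complex_norm_square mult.commute del: of_real_power)
    then have "(\<Sum>i\<in>UNIV. (cmod (A $ i $ j))\<^sup>2) = 0"
      using assms by (simp only: zero_index of_real_eq_0_iff)
    then show ?thesis
      by (simp add: sum_nonneg_eq_0_iff)
  qed
  then show ?thesis by (simp add: vec_eq_iff)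
qed

lemma matrix_sub_ldistrib:
  fixes A :: "'a::ring_1^'n^'m"
  shows "A ** (B - C) = A ** B - A ** C"
  by (simp add: matrix_matrix_mult_def vec_eq_iff sum_subtractf algebra_simps)

lemma matrix_sub_rdistrib:
  fixes A B :: "'a::ring_1^'n^'m"
  shows "(A - B) ** C = A ** C - B ** C"
  by (simp add: matrix_matrix_mult_def vec_eq_iff sum_subtractf algebra_simps)

lemma conj_transpose_mult_cancel_left:
  fixes A :: "complex^'a^'m" and B C :: "complex^'b^'a"
  assumes "conj_transpose A ** A ** B = conj_transpose A ** A ** C"
  shows "A ** B = A ** C"
proof -
  have "conj_transpose (A ** (B - C)) ** (A ** (B - C))
      = conj_transpose (B - C) ** (conj_transpose A ** A ** (B - C))"
    by (simp only: conj_transpose_mult matrix_mul_assoc)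
  also have "conj_transpose A ** A ** (B - C) = 0"
    by (simp only: matrix_sub_ldistrib assms diff_self)
  also have "conj_transpose (B - C) ** (0 :: complex^'b^'a) = 0"
    by (simp add: matrix_matrix_mult_def vec_eq_iff)
  finally have "A ** (B - C) = 0"
    by (rule conj_transpose_mult_self_eq_0)
  then show ?thesis
    by (simp add: matrix_sub_ldistrib)
qed

text \<open>An inner inverse \<open>G\<close> of \<open>A\<^sup>* ** A\<close> yields \<open>P = A ** G ** A\<^sup>*\<close> with \<open>P ** A = A\<close>, hence
  \<open>P ** P\<^sup>* = P\<^sup>*\<close>, so \<open>P\<close> is Hermitian: the orthogonal projection onto the range of \<open>A\<close>.\<close>

lemma exists_range_projection:
  fixes A :: "complex^'n^'m"
  obtains G where "A ** G ** conj_transpose A ** A = A"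
    "conj_transpose (A ** G ** conj_transpose A) = A ** G ** conj_transpose A"
proof -
  let ?S = "conj_transpose A ** A"
  obtain G where "?S ** G ** ?S = ?S"
    by (rule exists_inner_inverse)
  then have "?S ** (G ** ?S) = ?S ** mat 1"
    by (simp add: matrix_mul_assoc)
  then have "A ** (G ** ?S) = A ** mat 1"
    by (rule conj_transpose_mult_cancel_left)
  then have PA: "A ** G ** conj_transpose A ** A = A"
    by (simp add: matrix_mul_assoc)
  let ?P = "A ** G ** conj_transpose A"
  have "?P ** conj_transpose ?P = conj_transpose ?P"
    by (simp only: conj_transpose_mult conj_transpose_conj_transpose matrix_mul_assoc PA)
  then have "conj_transpose ?P = ?P"
    by (metis conj_transpose_mult conj_transpose_conj_transpose)
  with PA that show thesis by blast
qed

lemma exists_moore_penrose_inverse: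
  fixes A :: "complex^'n^'m"
  obtains X where "is_moore_penrose_inverse A X"
proof -
  let ?B = "conj_transpose A"
  obtain G where G: "A ** G ** ?B ** A = A" "conj_transpose (A ** G ** ?B) = A ** G ** ?B"
    by (rule exists_range_projection)
  \<comment> \<open>The projection for \<open>A\<^sup>*\<close> supplies the row space side.\<close>
  obtain H where H: "?B ** H ** A ** ?B = ?B" "conj_transpose (?B ** H ** A) = ?B ** H ** A"
    using exists_range_projection[of ?B] by auto
  have AH: "A ** ?B ** H ** A = A"
    by (metis H conj_transpose_mult conj_transpose_conj_transpose matrix_mul_assoc)
  let ?X = "?B ** H ** A ** G ** ?B"
  have AX: "A ** ?X = A ** G ** ?B"
    by (simp only: AH matrix_mul_assoc)
  have "?X ** A = ?B ** H ** (A ** G ** ?B ** A)"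
    by (simp only: matrix_mul_assoc)
  then have XA: "?X ** A = ?B ** H ** A"
    by (simp only: G(1))
  have "is_moore_penrose_inverse A ?X"
    unfolding is_moore_penrose_inverse_def AX XA
    by (simp only: G H matrix_mul_assoc simp_thms)
  with that show thesis by blast
qed

text \<open>\<open>A ** X\<close> and \<open>A ** Y\<close> are Hermitian and each acts as the identity on the range of the other, so
  taking the conjugate transpose of their product identifies them.  For \<open>X ** A\<close> and \<open>Y ** A\<close> the
  product keeps the left factor instead of the right one.\<close>

lemma moore_penrose_inverse_unique:
  assumes "is_moore_penrose_inverse A X" and "is_moore_penrose_inverse A Y"
  shows "X = Y"
proof -
  have X: "A ** X ** A = A" "X ** A ** X = X"
      "conj_transpose (A ** X) = A ** X" "conj_transpose (X ** A) = X ** A"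
    and Y: "A ** Y ** A = A" "Y ** A ** Y = Y"
      "conj_transpose (A ** Y) = A ** Y" "conj_transpose (Y ** A) = Y ** A"
    using assms by (simp_all only: is_moore_penrose_inverse_def)
  have "A ** X = A ** Y ** (A ** X)"
    by (metis Y(1) matrix_mul_assoc)
  also have "\<dots> = conj_transpose (A ** X ** (A ** Y))"
    by (simp only: conj_transpose_mult[of "A ** X"] X Y)
  also have "\<dots> = A ** Y"
    by (metis X(1) Y(3) matrix_mul_assoc)
  finally have AX: "A ** X = A ** Y" .
  have "X ** A = X ** A ** (Y ** A)"
    by (metis Y(1) matrix_mul_assoc)
  also have "\<dots> = conj_transpose (Y ** A ** (X ** A))"
    by (simp only: conj_transpose_mult[of "Y ** A"] X Y)
  also have "\<dots> = Y ** A"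
    by (metis X(1) Y(4) matrix_mul_assoc)
  finally have XA: "X ** A = Y ** A" .
  show ?thesis
    by (metis AX XA X(2) Y(2) matrix_mul_assoc)
qed

section \<open>Tensors through their transformed slices\<close>

lemma tensor_eqI:
  assumes "invertible M" and "\<And>i. transform_slice M C i = transform_slice M D i"
  shows "C = D"
  using ex1_transform_slice[OF assms(1), of "transform_slice M D"] assms(2) by blast

lemma tensor_eq_iff:
  assumes "invertible M"
  shows "C = D \<longleftrightarrow> (\<forall>i. transform_slice M C i = transform_slice M D i)"
  using tensor_eqI[OF assms] by blast

lemma transform_slice_add:
  "transform_slice M (C + D) i = transform_slice M C i + transform_slice M D i"
  by (simp add: frontal_slice_def vec_eq_iff transform_nth matrix_vector_right_distrib)

lemma transform_slice_diff:
  "transform_slice M (C - D) i = transform_slice M C i - transform_slice M D i"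
  by (simp add: frontal_slice_def vec_eq_iff transform_nth matrix_vector_mult_diff_distrib)

lemma transform_slice_mpower:
  assumes "invertible M"
  shows "transform_slice M (mpower M A n) i = matrix_power (transform_slice M A i) n"
  by (induction n) (simp_all add: assms transform_slice_ident_tensor transform_slice_mprod)

text \<open>A definite description of a tensor whose defining equations decouple into one matrix condition
  per slice, each with exactly one solution.\<close>

lemma transform_slice_The:
  fixes M :: "complex^'p^'p" and P :: "'p::finite \<Rightarrow> complex^'n^'m \<Rightarrow> bool"
  assumes M: "invertible M"
    and slices: "\<And>X. Q X \<longleftrightarrow> (\<forall>i. P i (transform_slice M X i))"
    and ex: "\<And>i. \<exists>S. P i S" and unique: "\<And>i S T. P i S \<Longrightarrow> P i T \<Longrightarrow> S = T"
  shows "P i (transform_slice M (THE X. Q X) i)"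
proof -
  obtain F where F: "\<And>i. P i (F i)"
    using ex by metis
  obtain C where C: "\<And>i. transform_slice M C i = F i"
    using ex1_transform_slice[OF M, of F] by blast
  have "Q C"
    using F by (simp add: slices C)
  moreover have "X = C" if "Q X" for X
    using that \<open>Q C\<close> by (intro tensor_eqI[OF M] unique) (auto simp: slices)
  ultimately have "Q (THE X. Q X)"
    by (rule theI)
  then show ?thesis
    by (simp add: slices)
qed

lemma transform_slice_moore_penrose_inverse:
  assumes "invertible M"
  shows "is_moore_penrose_inverse (transform_slice M A i)
    (transform_slice M (moore_penrose_inverse M A) i)"
  unfolding moore_penrose_inverse_def
proof (rule transform_slice_The[OF assms,
      where P = "\<lambda>i. is_moore_penrose_inverse (transform_slice M A i)"])
  show "\<exists>S. is_moore_penrose_inverse (transform_slice M A j) S" for j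
    using exists_moore_penrose_inverse by blast
next
  show "S = T" if "is_moore_penrose_inverse (transform_slice M A j) S"
    "is_moore_penrose_inverse (transform_slice M A j) T" for j S T
    using that by (rule moore_penrose_inverse_unique)
qed (simp add: tensor_eq_iff[OF assms] transform_slice_mprod[OF assms]
    transform_slice_tensor_conj_transpose[OF assms] is_moore_penrose_inverse_def all_conj_distrib)

lemma transform_slice_drazin_inverse:
  assumes "invertible M"
  shows "is_drazin_inverse (transform_slice M A i) (tubal_index M A)
    (transform_slice M (drazin_inverse M A) i)"
  unfolding drazin_inverse_def
proof (rule transform_slice_The[OF assms,
      where P = "\<lambda>i. is_drazin_inverse (transform_slice M A i) (tubal_index M A)"])
  show "\<exists>S. is_drazin_inverse (transform_slice M A j) (tubal_index M A) S" for j
  proof -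
    have "matrix_index (transform_slice M A j) \<le> tubal_index M A"
      by (simp add: tubal_index_def)
    then show ?thesis
      using exists_drazin_inverse by blast
  qed
next
  show "S = T" if "is_drazin_inverse (transform_slice M A j) (tubal_index M A) S"
    "is_drazin_inverse (transform_slice M A j) (tubal_index M A) T" for j S T
    using that by (rule drazin_inverse_unique)
qed (simp add: tensor_eq_iff[OF assms] transform_slice_mprod[OF assms]
    transform_slice_mpower[OF assms] is_drazin_inverse_def all_conj_distrib
    del: mpower.simps matrix_power.simps)

section \<open>The equation on one slice\<close>

lemma drazin_power_mult:
  assumes "is_drazin_inverse A k D"
  shows "matrix_power A k ** D ** A = matrix_power A k"
  by (metis assms is_drazin_inverse_def matrix_power_commute matrix_mul_assoc
      matrix_power_Suc_right Suc_eq_plus1)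

text \<open>Writing \<open>A\<^sup>k = A\<^sup>k ** D ** A\<close> provides a factor \<open>A\<close> on the right also when \<open>k = 0\<close>.\<close>

lemma drazin_power_mult_inner_inverse:
  assumes "is_drazin_inverse A k D" "A ** P ** A = A"
  shows "matrix_power A k ** P ** A = matrix_power A k"
  by (metis drazin_power_mult[OF assms(1)] assms(2) matrix_mul_assoc)

lemma power_mult_cmp:
  assumes "is_drazin_inverse A k D" "A ** P ** A = A"
  shows "matrix_power A k ** (P ** A ** D ** A ** P) = matrix_power A k ** P"
  by (metis drazin_power_mult[OF assms(1)] drazin_power_mult_inner_inverse[OF assms] matrix_mul_assoc)

text \<open>Both sides are \<open>P ** A ** W\<close> applied to the two sides of the equation, where
  \<open>D ** A = W ** A\<^sup>k\<close>.\<close>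

lemma cmp_mult_eq_of_power_mult_eq:
  assumes D: "is_drazin_inverse A k D" and P: "A ** P ** A = A"
    and eq: "matrix_power A k ** Y = matrix_power A k ** P ** B"
  shows "P ** A ** D ** A ** P ** A ** Y = P ** A ** D ** A ** P ** B"
proof -
  obtain W where W: "D ** A = W ** matrix_power A k"
    using D drazin_projection_factor[of D A k] by (metis is_drazin_inverse_def)
  have "P ** A ** D ** A ** P ** A ** Y = P ** A ** (D ** A) ** Y"
    by (metis P matrix_mul_assoc)
  also have "\<dots> = P ** A ** W ** (matrix_power A k ** Y)"
    by (simp only: W matrix_mul_assoc)
  also have "\<dots> = P ** A ** (D ** A) ** P ** B"
    by (simp only: W eq matrix_mul_assoc)
  finally show ?thesis
    by (simp only: matrix_mul_assoc)
qed

section \<open>The solution set of the tensor equation\<close>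

theorem theorem6p5:
  fixes M :: "complex^'p^'p"
    and A :: "('p::finite, 'm::finite, 'm) tensor"
    and B :: "('p, 1, 'm) tensor"
    and k :: nat
  assumes "invertible M"
    and "tubal_index M A = k"
  shows "{Y :: ('p, 1, 'm) tensor.
            mpower M A k \<star>\<^bsub>M\<^esub> Y = mpower M A k \<star>\<^bsub>M\<^esub> moore_penrose_inverse M A \<star>\<^bsub>M\<^esub> B}
       = {cmp_inverse M A \<star>\<^bsub>M\<^esub> B + (ident_tensor M - cmp_inverse M A \<star>\<^bsub>M\<^esub> A) \<star>\<^bsub>M\<^esub> Z
            | Z :: ('p, 1, 'm) tensor. True}"
proof -
  let ?C = "cmp_inverse M A"
  define a where "a = transform_slice M A"
  define d where "d = transform_slice M (drazin_inverse M A)"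
  define p where "p = transform_slice M (moore_penrose_inverse M A)"
  note slice = tensor_eq_iff[OF assms(1)] transform_slice_mprod[OF assms(1)]
    transform_slice_mpower[OF assms(1)] transform_slice_ident_tensor[OF assms(1)]
    transform_slice_add transform_slice_diff
  have D: "is_drazin_inverse (a i) k (d i)" for i
    using transform_slice_drazin_inverse[OF assms(1), of A i] assms(2) by (simp add: a_def d_def)
  have P: "a i ** p i ** a i = a i" for i
    using transform_slice_moore_penrose_inverse[OF assms(1), of A i]
    by (simp add: a_def p_def is_moore_penrose_inverse_def)
  have C: "transform_slice M ?C i = p i ** a i ** d i ** a i ** p i" for i
    by (simp add: cmp_inverse_def slice a_def d_def p_def)
  have "?C \<star>\<^bsub>M\<^esub> B + (ident_tensor M - ?C \<star>\<^bsub>M\<^esub> A) \<star>\<^bsub>M\<^esub> Y = Y"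
    if "mpower M A k \<star>\<^bsub>M\<^esub> Y = mpower M A k \<star>\<^bsub>M\<^esub> moore_penrose_inverse M A \<star>\<^bsub>M\<^esub> B"
    for Y :: "('p, 1, 'm) tensor"
  proof -
    have "matrix_power (a i) k ** transform_slice M Y i
        = matrix_power (a i) k ** p i ** transform_slice M B i" for i
      using that by (simp add: slice a_def p_def)
    from cmp_mult_eq_of_power_mult_eq[OF D P this] show ?thesis
      by (simp add: slice C matrix_sub_rdistrib flip: a_def)
  qed
  moreover have "mpower M A k \<star>\<^bsub>M\<^esub> (?C \<star>\<^bsub>M\<^esub> B + (ident_tensor M - ?C \<star>\<^bsub>M\<^esub> A) \<star>\<^bsub>M\<^esub> Z)
      = mpower M A k \<star>\<^bsub>M\<^esub> moore_penrose_inverse M A \<star>\<^bsub>M\<^esub> B" for Z :: "('p, 1, 'm) tensor"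
  proof -
    have "matrix_power (a i) k ** (p i ** a i ** d i ** a i ** p i) = matrix_power (a i) k ** p i"
      "matrix_power (a i) k ** p i ** a i = matrix_power (a i) k" for i
      by (rule power_mult_cmp[OF D P], rule drazin_power_mult_inner_inverse[OF D P])
    then show ?thesis
      by (simp add: slice C matrix_sub_rdistrib matrix_sub_ldistrib matrix_add_ldistrib
          matrix_mul_assoc flip: a_def p_def)
  qed
  ultimately show ?thesis
    by (auto intro: sym)
qed

end
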